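(* Let $G$ be a connected, locally finite rooted graph and let $L(n)$ be the combined lifespans of $n$ particles executing internal diffusion-limited aggregation from the root of $G$. Let $\eta$ and $\eta'$ be nonnegative integer-valued random variables, independent of the aggregation process. If $\eta\preceq_{icx}\eta'$, then $L(\eta)\preceq_{icx}L(\eta')$.
   Context: Increasing convex order: for random variables $X,Y$, $X\preceq_{icx}Y$ means $\mathbf E\varphi(X)\le\mathbf E\varphi(Y)$ for all increasing (i.e. nondecreasing) convex $\varphi:\mathbb R\to\mathbb R$ for which the expectations exist. For $[0,\infty]$-valued random variables one sets $\varphi(\infty)=\lim_{u\to\infty}\varphi(u)$. Internal diffusion-limited aggregation (sequential version): initially the root is the only occupied vertex and every non-root vertex is unoccupied. Particles are released one after the other from the root. Each particle performs an independent discrete-time simple random walk on $G$ started at the root until it first reaches an unoccupied vertex, where it stops for good and which becomes occupied; then the next particle is released. The lifespan of a particle is the number of steps its walk takes before it stops (equal to $\infty$ if it never stops), and $L(n)\in[0,\infty]$ is the sum of the lifespans of the first $n$ particles, $L(0)=0$. (This corresponds to the annihilating particle system with $n$ mobile $A$-particles at the root and one stationary $B$-particle at each non-root vertex.) *)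

theory Defs
  imports "HOL-Probability.Probability" "HOL-Library.Extended_Nat"
begin

section \<open>Graphs and simple random walk\<close>

locale rooted_graph =
  fixes V :: "'v set" and E :: "'v \<Rightarrow> 'v \<Rightarrow> bool" and r :: 'v
  assumes root: "r \<in> V"
    and edge_in: "E u v \<Longrightarrow> u \<in> V \<and> v \<in> V"
    and edge_sym: "E u v \<Longrightarrow> E v u"
    and edge_irrefl: "\<not> E v v"
    and locally_finite: "v \<in> V \<Longrightarrow> finite {u. E v u}"
    and connected: "u \<in> V \<Longrightarrow> v \<in> V \<Longrightarrow> E\<^sup>*\<^sup>* u v"

text \<open>An isolated vertex occurs in a connected graph only if it is the sole vertex;
  the walk then stays put.\<close>

definition srw_step :: "('v \<Rightarrow> 'v \<Rightarrow> bool) \<Rightarrow> 'v \<Rightarrow> 'v pmf" where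
  "srw_step E v = (if {u. E v u} = {} then return_pmf v else pmf_of_set {u. E v u})"

definition path_space :: "'v set \<Rightarrow> (nat \<Rightarrow> 'v) measure" where
  "path_space V = (\<Pi>\<^sub>M t\<in>UNIV. count_space V)"

text \<open>The last clause is the Markov property, multiplied out so that conditioning on null
  events needs no convention.\<close>

definition simple_random_walk ::
  "'a measure \<Rightarrow> 'v set \<Rightarrow> ('v \<Rightarrow> 'v \<Rightarrow> bool) \<Rightarrow> 'v \<Rightarrow> ('a \<Rightarrow> nat \<Rightarrow> 'v) \<Rightarrow> bool" where
  "simple_random_walk M V E r X \<longleftrightarrow>
     X \<in> measurable M (path_space V) \<and>
     (AE \<omega> in M. X \<omega> 0 = r) \<and>
     (\<forall>n v. measure M {\<omega> \<in> space M. \<forall>t\<le>Suc n. X \<omega> t = v t} =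
            measure M {\<omega> \<in> space M. \<forall>t\<le>n. X \<omega> t = v t} * pmf (srw_step E (v n)) (v (Suc n)))"

section \<open>Internal diffusion-limited aggregation\<close>

text \<open>Throughout, \<open>w i t\<close> is the position after \<open>t\<close> steps of the walk assigned to the
  \<open>i\<close>-th particle, counting particles from 0. The infimum of the empty set of extended naturals
  is \<open>\<infinity>\<close>.\<close>

definition exit_time :: "'v set \<Rightarrow> (nat \<Rightarrow> 'v) \<Rightarrow> enat" where
  "exit_time A p = (INF t\<in>{t. p t \<notin> A}. enat t)"

fun idla_occupied :: "'v \<Rightarrow> (nat \<Rightarrow> nat \<Rightarrow> 'v) \<Rightarrow> nat \<Rightarrow> 'v set" where
  "idla_occupied r w 0 = {r}"
| "idla_occupied r w (Suc n) =
     (case exit_time (idla_occupied r w n) (w n) of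
        enat t \<Rightarrow> insert (w n t) (idla_occupied r w n)
      | \<infinity> \<Rightarrow> idla_occupied r w n)"

definition idla_lifespan :: "'v \<Rightarrow> (nat \<Rightarrow> nat \<Rightarrow> 'v) \<Rightarrow> nat \<Rightarrow> enat" where
  "idla_lifespan r w i = exit_time (idla_occupied r w i) (w i)"

definition idla_total_lifespan :: "'v \<Rightarrow> (nat \<Rightarrow> nat \<Rightarrow> 'v) \<Rightarrow> nat \<Rightarrow> enat" where
  "idla_total_lifespan r w n = (\<Sum>i<n. idla_lifespan r w i)"

text \<open>The aggregation process: the particle trajectories, each frozen once its particle stops.
  The steps of \<open>w i\<close> after that time are not part of it.\<close>

definition idla_process :: "'v \<Rightarrow> (nat \<Rightarrow> nat \<Rightarrow> 'v) \<Rightarrow> nat \<Rightarrow> nat \<Rightarrow> 'v" where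
  "idla_process r w i t = w i (the_enat (min (enat t) (idla_lifespan r w i)))"

text \<open>\<^const>\<open>prob_space.indep_var\<close> needs both variables to have values in the same type;
  this is independence of the generated sigma-algebras for differing types.\<close>

definition indep_variables ::
  "'a measure \<Rightarrow> 'b measure \<Rightarrow> ('a \<Rightarrow> 'b) \<Rightarrow> 'c measure \<Rightarrow> ('a \<Rightarrow> 'c) \<Rightarrow> bool" where
  "indep_variables M K X N Y \<longleftrightarrow>
     X \<in> measurable M K \<and> Y \<in> measurable M N \<and>
     prob_space.indep_set M {X -` A \<inter> space M | A. A \<in> sets K} {Y -` B \<inter> space M | B. B \<in> sets N}"

section \<open>Increasing convex order\<close>

text \<open>Expectation in the extended sense: it exists unless both the positive and the negative part
  have infinite integral. Note that \<open>e2ennreal\<close> sends negative arguments to 0.\<close>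

definition expectation_exists :: "'a measure \<Rightarrow> ('a \<Rightarrow> ereal) \<Rightarrow> bool" where
  "expectation_exists M f \<longleftrightarrow>
     (\<integral>\<^sup>+ \<omega>. e2ennreal (f \<omega>) \<partial>M) < \<infinity> \<or> (\<integral>\<^sup>+ \<omega>. e2ennreal (- f \<omega>) \<partial>M) < \<infinity>"

definition ext_expectation :: "'a measure \<Rightarrow> ('a \<Rightarrow> ereal) \<Rightarrow> ereal" where
  "ext_expectation M f =
     enn2ereal (\<integral>\<^sup>+ \<omega>. e2ennreal (f \<omega>) \<partial>M) - enn2ereal (\<integral>\<^sup>+ \<omega>. e2ennreal (- f \<omega>) \<partial>M)"

definition extend_fun :: "(real \<Rightarrow> real) \<Rightarrow> ereal \<Rightarrow> ereal" where
  "extend_fun \<phi> x =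
     (if x = \<infinity> then Lim at_top (\<lambda>u. ereal (\<phi> u))
      else if x = -\<infinity> then Lim at_bot (\<lambda>u. ereal (\<phi> u))
      else ereal (\<phi> (real_of_ereal x)))"

text \<open>Extended-real-valued variables cover real-valued and \<open>[0,\<infinity>]\<close>-valued ones alike;
  the value \<open>-\<infinity>\<close> is treated symmetrically only for totality.\<close>

definition icx_le ::
  "'a measure \<Rightarrow> ('a \<Rightarrow> ereal) \<Rightarrow> 'b measure \<Rightarrow> ('b \<Rightarrow> ereal) \<Rightarrow> bool" where
  "icx_le M X N Y \<longleftrightarrow>
     X \<in> borel_measurable M \<and> Y \<in> borel_measurable N \<and>
     (\<forall>\<phi>. mono \<phi> \<and> convex_on UNIV \<phi> \<and>
          expectation_exists M (\<lambda>\<omega>. extend_fun \<phi> (X \<omega>)) \<and>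
          expectation_exists N (\<lambda>\<omega>. extend_fun \<phi> (Y \<omega>)) \<longrightarrow>
          ext_expectation M (\<lambda>\<omega>. extend_fun \<phi> (X \<omega>)) \<le>
          ext_expectation N (\<lambda>\<omega>. extend_fun \<phi> (Y \<omega>)))"

end

(* Let phi be increasing and convex. Given the first n walks, with occupied set A and combined
   lifespan l, let a be the exit time from A of walk n, and let b' and b be the exit times of
   walk n + 1 from A and from the set occupied after particle n. Then b' <= b, so convexity gives
   phi(l + a) + phi(l + b') <= phi(l) + phi(l + a + b). Since walks n and n + 1 are exchangeable,
   l + b' has the law of L(n + 1), so n |-> E phi(L(n)) is convex; it is also increasing.
   After normalising it to vanish at 0, such a sequence is a nonnegative combination of the
   hinges n |-> (n - k)^+, and the hypothesis on eta and eta' applies to each of these.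
   This passes to L(eta) because L(n) depends only on the stopped trajectories, which are
   independent of eta. Coefficients in [0,oo] take care of infinite expectations without case distinctions. *)

theory Submission
  imports Defs
begin

section \<open>The aggregation process\<close>

lemma exit_time_eq_enat_iff: "exit_time A p = enat t \<longleftrightarrow> p t \<notin> A \<and> (\<forall>s<t. p s \<in> A)"
proof
  assume eq: "exit_time A p = enat t"
  have le: "t \<le> s" if "p s \<notin> A" for s
  proof -
    have "exit_time A p \<le> enat s"
      using that unfolding exit_time_def by (intro INF_lower) auto
    with eq show ?thesis by simp
  qed
  \<comment> \<open>A finite infimum comes from a nonempty set, so well-ordering of
    \<open>enat\<close> makes it an attained minimum.\<close>
  have "enat ` {s. p s \<notin> A} \<noteq> {}"
    using eq by (fastforce simp: exit_time_def top_enat_def)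
  then have "exit_time A p \<in> enat ` {s. p s \<notin> A}"
    unfolding exit_time_def by (metis ex_in_conv wellorder_InfI)
  with eq have "p t \<notin> A" by auto
  with le show "p t \<notin> A \<and> (\<forall>s<t. p s \<in> A)"
    by (meson leD)
next
  assume *: "p t \<notin> A \<and> (\<forall>s<t. p s \<in> A)"
  then have "t \<le> s" if "p s \<notin> A" for s
    using that by (meson leI)
  with * show "exit_time A p = enat t"
    unfolding exit_time_def
    by (intro antisym INF_lower2[of t] INF_greatest) auto
qed

lemma exit_time_eq_infinity_iff: "exit_time A p = \<infinity> \<longleftrightarrow> (\<forall>t. p t \<in> A)"
proof
  assume eq: "exit_time A p = \<infinity>"
  show "\<forall>t. p t \<in> A"
  proof (rule ccontr)
    assume "\<not> (\<forall>t. p t \<in> A)"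
    then obtain s where "p s \<notin> A" by auto
    then have "exit_time A p \<le> enat s"
      unfolding exit_time_def by (intro INF_lower) auto
    with eq show False by simp
  qed
next
  assume "\<forall>t. p t \<in> A"
  then show "exit_time A p = \<infinity>"
    by (simp add: exit_time_def top_enat_def)
qed

lemma exit_time_mono: "A \<subseteq> B \<Longrightarrow> exit_time A p \<le> exit_time B p"
  unfolding exit_time_def by (rule INF_superset_mono) auto

text \<open>Freezing a path at its exit time T alters no position up to T, and these positions alone
  determine T. If T is infinite, nothing is frozen.\<close>

lemma exit_time_stopped:
  "exit_time A (\<lambda>t. p (the_enat (min (enat t) (exit_time A p)))) = exit_time A p"
proof (cases "exit_time A p")
  case (enat T)
  then have "p T \<notin> A" "\<forall>s<T. p s \<in> A"
    unfolding exit_time_eq_enat_iff by blast+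
  then have "exit_time A (\<lambda>t. p (min t T)) = enat T"
    unfolding exit_time_eq_enat_iff by (auto simp: min_def)
  then show ?thesis
    unfolding enat min_enat_simps the_enat.simps .
next
  case infinity
  show ?thesis
    unfolding infinity min_enat_simps the_enat.simps ..
qed

lemma idla_occupied_Suc_superset: "idla_occupied r w n \<subseteq> idla_occupied r w (Suc n)"
  by (auto split: enat.split)

lemma mem_idla_occupied_Suc_iff:
  "v \<in> idla_occupied r w (Suc n) \<longleftrightarrow>
     v \<in> idla_occupied r w n \<or> (\<exists>t. idla_lifespan r w n = enat t \<and> w n t = v)"
  by (auto simp: idla_lifespan_def split: enat.split)

text \<open>Walks with index at least n are invisible to the set occupied after n particles; hence
  walks \<open>n\<close> and \<open>Suc n\<close> may later be swapped without disturbing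
  it.\<close>

lemma idla_occupied_cong:
  "(\<And>i. i < n \<Longrightarrow> w i = w' i) \<Longrightarrow> idla_occupied r w n = idla_occupied r w' n"
proof (induction n)
  case (Suc n)
  then have "idla_occupied r w n = idla_occupied r w' n" "w n = w' n"
    by auto
  then show ?case by (simp cong: enat.case_cong)
qed simp

lemma idla_total_lifespan_cong:
  "(\<And>i. i < n \<Longrightarrow> w i = w' i) \<Longrightarrow> idla_total_lifespan r w n = idla_total_lifespan r w' n"
  unfolding idla_total_lifespan_def idla_lifespan_def
  by (intro sum.cong refl arg_cong2[where f = exit_time] idla_occupied_cong) auto

lemma idla_occupied_process: "idla_occupied r (idla_process r w) n = idla_occupied r w n"
proof (induction n)
  case 0
  show ?case by simp
next
  case (Suc n)
  have "exit_time (idla_occupied r w n) (idla_process r w n) = exit_time (idla_occupied r w n) (w n)"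
    unfolding idla_process_def idla_lifespan_def by (rule exit_time_stopped)
  moreover have "idla_process r w n t = w n t" if "exit_time (idla_occupied r w n) (w n) = enat t" for t
    using that by (simp add: idla_process_def idla_lifespan_def)
  ultimately show ?case
    using Suc by (simp split: enat.split)
qed

text \<open>Makes the total lifespan a function of the stopped trajectories, which are the object
  that the random index is assumed independent of.\<close>

lemma idla_total_lifespan_process:
  "idla_total_lifespan r (idla_process r w) n = idla_total_lifespan r w n"
  unfolding idla_total_lifespan_def idla_lifespan_def[of r "idla_process r w"] idla_occupied_process
  unfolding idla_process_def by (simp add: idla_lifespan_def exit_time_stopped)

section \<open>Countability of the vertex set and measurability of the lifespans\<close>

text \<open>By connectedness every vertex is reachable from the root, and a relation with finite
  branching reaches only countably many points. Countability lets random positions be treated by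
  cases on their value.\<close>

lemma (in rooted_graph) countable_vertices: "countable V"
proof -
  let ?R = "{(u, v). u \<in> V \<and> E u v}"
  have fin: "finite (?R `` {u})" for u
  proof (cases "u \<in> V")
    case True
    then have "?R `` {u} = {v. E u v}" by blast
    with locally_finite[OF True] show ?thesis by simp
  next
    case False
    then have "?R `` {u} = {}" by blast
    then show ?thesis by (simp only: finite.emptyI)
  qed
  have step: "countable (?R `` Y)" if "countable Y" for Y
    by (subst Image_eq_UN) (rule countable_UN[OF that countable_finite[OF fin]])
  have "countable (?R\<^sup>* `` {r})"
    by (rule countable_rtrancl[OF step countable_finite]) simp_all
  moreover have "V \<subseteq> ?R\<^sup>* `` {r}"
  proof
    fix v assume "v \<in> V"
    then have "E\<^sup>*\<^sup>* r v" using connected root by blast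
    then have "(r, v) \<in> ?R\<^sup>*"
    proof (induction rule: rtranclp_induct)
      case (step y z)
      then show ?case using edge_in[of y z] rtrancl_into_rtrancl[of r y ?R z] by blast
    qed simp
    then show "v \<in> ?R\<^sup>* `` {r}" by blast
  qed
  ultimately show ?thesis by (rule countable_subset[rotated])
qed

lemma space_path_space: "space (path_space V) = UNIV \<rightarrow>\<^sub>E V"
  by (simp add: path_space_def space_PiM)

lemma measurable_path_space_component:
  "f \<in> measurable N (path_space V) \<Longrightarrow> (\<lambda>x. f x t) \<in> measurable N (count_space V)"
  unfolding path_space_def by (erule measurable_compose) simp

context
  fixes V :: "'v set" and r :: 'v
  assumes countable_V: "countable V" and r_in_V: "r \<in> V"
begin

text \<open>The random set \<open>A\<close> is controlled only through membership of each fixed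
  vertex. This suffices because the position of the path ranges over the countable set
  \<open>V\<close>, and because \<open>enat\<close> is countable, so that single values of the exit
  time can be checked one by one.\<close>

lemma measurable_exit_time:
  assumes p: "p \<in> measurable N (path_space V)"
    and A: "\<And>v. v \<in> V \<Longrightarrow> Measurable.pred N (\<lambda>x. v \<in> A x)"
  shows "(\<lambda>x. exit_time (A x) (p x)) \<in> measurable N (count_space UNIV)"
proof -
  have [measurable]: "(\<lambda>x. p x t) \<in> measurable N (count_space V)" for t
    using p by (rule measurable_path_space_component)
  have mem [measurable]: "Measurable.pred N (\<lambda>x. p x t \<in> A x)" for t
  proof -
    \<comment> \<open>Splitting over the value v of \<open>p x t\<close> replaces membership of a
      random point by membership of fixed points.\<close>
    have "Measurable.pred N (\<lambda>x. \<exists>v\<in>V. p x t = v \<and> v \<in> A x)"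
    proof (rule measurable_pred_countable(2)[OF countable_V])
      fix v assume v: "v \<in> V"
      note A[OF v, measurable]
      show "Measurable.pred N (\<lambda>x. p x t = v \<and> v \<in> A x)"
        using v by measurable
    qed
    also have "?this \<longleftrightarrow> ?thesis"
      by (intro measurable_cong) (use measurable_space[OF p] in \<open>auto simp: space_path_space PiE_def Pi_def\<close>)
    finally show ?thesis .
  qed
  show ?thesis
    unfolding measurable_count_space_eq2_countable
  proof (intro conjI ballI)
    fix a :: enat
    show "(\<lambda>x. exit_time (A x) (p x)) -` {a} \<inter> space N \<in> sets N"
    proof (cases a)
      case (enat t)
      have "(\<lambda>x. exit_time (A x) (p x)) -` {a} \<inter> space N =
          {x \<in> space N. p x t \<notin> A x \<and> (\<forall>s<t. p x s \<in> A x)}"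
        by (auto simp: enat exit_time_eq_enat_iff)
      also have "\<dots> \<in> sets N" by measurable
      finally show ?thesis .
    next
      case infinity
      have "(\<lambda>x. exit_time (A x) (p x)) -` {a} \<inter> space N = {x \<in> space N. \<forall>t. p x t \<in> A x}"
        by (auto simp: infinity exit_time_eq_infinity_iff)
      also have "\<dots> \<in> sets N" by measurable
      finally show ?thesis .
    qed
  qed simp
qed

text \<open>The induction must cover all vertices at once, since the next exit time depends on the
  whole occupied set.\<close>

lemma measurable_pred_mem_idla_occupied:
  assumes "v \<in> V"
  shows "Measurable.pred (PiM UNIV (\<lambda>_. path_space V)) (\<lambda>w. v \<in> idla_occupied r w n)"
  using assms
proof (induction n arbitrary: v)
  case 0
  show ?case by simp
next
  case (Suc n)
  let ?P = "PiM UNIV (\<lambda>_. path_space V) :: (nat \<Rightarrow> nat \<Rightarrow> 'v) measure"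
  note Suc.IH[OF Suc.prems, measurable]
  have [measurable]: "(\<lambda>w. w n) \<in> measurable ?P (path_space V)"
    by (rule measurable_component_singleton) simp
  have [measurable]: "(\<lambda>w. idla_lifespan r w n) \<in> measurable ?P (count_space UNIV)"
    unfolding idla_lifespan_def by (intro measurable_exit_time Suc.IH) auto
  have [measurable]: "Measurable.pred ?P (\<lambda>w. w n t = v)" for t
    using measurable_path_space_component[of "\<lambda>w. w n" ?P V t] Suc.prems by measurable
  show ?case
    unfolding mem_idla_occupied_Suc_iff by measurable
qed

text \<open>The walk index \<open>m\<close> is separate from \<open>n\<close> because the convexity
  argument also asks when walk \<open>Suc n\<close> leaves the set occupied after n
  particles.\<close>

lemma measurable_walk_exit_time:
  "(\<lambda>w. exit_time (idla_occupied r w n) (w m))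
     \<in> measurable (PiM UNIV (\<lambda>_. path_space V)) (count_space UNIV)"
  by (intro measurable_exit_time measurable_pred_mem_idla_occupied measurable_component_singleton) simp

lemma measurable_idla_total_lifespan:
  "(\<lambda>w. idla_total_lifespan r w n)
     \<in> measurable (PiM UNIV (\<lambda>_. path_space V)) (count_space UNIV)"
proof (induction n)
  case 0
  show ?case by (simp add: idla_total_lifespan_def)
next
  case (Suc n)
  have "(\<lambda>w. idla_total_lifespan r w n + exit_time (idla_occupied r w n) (w n))
      \<in> measurable (PiM UNIV (\<lambda>_. path_space V)) (count_space UNIV)"
    \<comment> \<open>Both summands take countably many values, so each can be fixed in turn and the
      sum becomes a constant.\<close>
    by (rule measurable_compose_countable[OF _ Suc],
        rule measurable_compose_countable[OF _ measurable_walk_exit_time]) simp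
  then show ?case
    by (simp add: idla_total_lifespan_def idla_lifespan_def)
qed

end

section \<open>The law of simple random walk\<close>

lemma simple_random_walk_start:
  assumes "prob_space M" and X: "simple_random_walk M V E r X" and v: "v \<in> V"
  shows "measure M {\<omega> \<in> space M. X \<omega> 0 = v} = (if v = r then 1 else 0)"
proof -
  interpret M: prob_space M by fact
  have [measurable]: "(\<lambda>\<omega>. X \<omega> 0) \<in> measurable M (count_space V)"
    using X by (intro measurable_path_space_component) (simp add: simple_random_walk_def)
  have sets: "{\<omega> \<in> space M. X \<omega> 0 = v} \<in> sets M"
    using v by measurable
  have ae: "AE \<omega> in M. X \<omega> 0 = r"
    using X by (simp add: simple_random_walk_def)
  show ?thesis
  proof (cases "v = r")
    case True
    with ae show ?thesis
      using M.prob_Collect_eq_1[OF sets] by simp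
  next
    case False
    with ae have "AE \<omega> in M. X \<omega> 0 \<noteq> v" by auto
    with False show ?thesis
      using M.prob_Collect_eq_0[OF sets] by simp
  qed
qed

text \<open>The starting point and one transition factor per step determine the probability of every
  finite initial path.\<close>

lemma simple_random_walk_cylinder_eq:
  assumes "prob_space M" "prob_space N"
    and X: "simple_random_walk M V E r X" and Y: "simple_random_walk N V E r Y"
    and v: "\<And>t. t \<le> n \<Longrightarrow> v t \<in> V"
  shows "measure M {\<omega> \<in> space M. \<forall>t\<le>n. X \<omega> t = v t} = measure N {\<omega> \<in> space N. \<forall>t\<le>n. Y \<omega> t = v t}"
  using v
proof (induction n)
  case 0
  show ?case
    using simple_random_walk_start[OF assms(1) X "0.prems"] simple_random_walk_start[OF assms(2) Y "0.prems"] by simp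
next
  case (Suc n)
  have "measure M {\<omega> \<in> space M. \<forall>t\<le>Suc n. X \<omega> t = v t} =
      measure M {\<omega> \<in> space M. \<forall>t\<le>n. X \<omega> t = v t} * pmf (srw_step E (v n)) (v (Suc n))"
    using X unfolding simple_random_walk_def by blast
  also have "measure M {\<omega> \<in> space M. \<forall>t\<le>n. X \<omega> t = v t} = measure N {\<omega> \<in> space N. \<forall>t\<le>n. Y \<omega> t = v t}"
    by (rule Suc.IH) (use Suc.prems in auto)
  also have "\<dots> * pmf (srw_step E (v n)) (v (Suc n)) = measure N {\<omega> \<in> space N. \<forall>t\<le>Suc n. Y \<omega> t = v t}"
    using Y unfolding simple_random_walk_def by metis
  finally show ?case .
qed

text \<open>A rectangle is a disjoint union of countably many path cylinders. Indexing by
  \<open>PiE\<close> fixes v beyond time n, so each cylinder is counted once.\<close>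

lemma emeasure_path_rectangle:
  assumes V: "countable V" and X: "X \<in> measurable M (path_space V)"
    and A: "\<And>t. t \<le> n \<Longrightarrow> A t \<subseteq> V"
  shows "emeasure M {\<omega> \<in> space M. \<forall>t\<le>n. X \<omega> t \<in> A t} =
    (\<integral>\<^sup>+ v. emeasure M {\<omega> \<in> space M. \<forall>t\<le>n. X \<omega> t = v t} \<partial>count_space (PiE {..n} A))"
proof -
  have [measurable]: "(\<lambda>\<omega>. X \<omega> t) \<in> measurable M (count_space V)" for t
    using X by (rule measurable_path_space_component)
  let ?C = "\<lambda>v. {\<omega> \<in> space M. \<forall>t\<le>n. X \<omega> t = v t}"
  have "{\<omega> \<in> space M. \<forall>t\<le>n. X \<omega> t \<in> A t} = (\<Union>v\<in>PiE {..n} A. ?C v)"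
  proof (intro set_eqI iffI)
    fix \<omega> assume *: "\<omega> \<in> {\<omega> \<in> space M. \<forall>t\<le>n. X \<omega> t \<in> A t}"
    then have "restrict (X \<omega>) {..n} \<in> PiE {..n} A" and "\<omega> \<in> ?C (restrict (X \<omega>) {..n})"
      by auto
    then show "\<omega> \<in> (\<Union>v\<in>PiE {..n} A. ?C v)" by blast
  next
    fix \<omega> assume "\<omega> \<in> (\<Union>v\<in>PiE {..n} A. ?C v)"
    then obtain v where "v \<in> PiE {..n} A" "\<omega> \<in> ?C v" by blast
    then show "\<omega> \<in> {\<omega> \<in> space M. \<forall>t\<le>n. X \<omega> t \<in> A t}"
      by (auto simp: PiE_iff)
  qed
  also have "emeasure M \<dots> = (\<integral>\<^sup>+ v. emeasure M (?C v) \<partial>count_space (PiE {..n} A))"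
  proof (rule emeasure_UN_countable)
    fix v assume "v \<in> PiE {..n} A"
    then have [simp]: "t \<le> n \<Longrightarrow> v t \<in> V" for t
      using A by (auto simp: PiE_iff)
    have "?C v = {\<omega> \<in> space M. \<forall>t\<in>{..n}. X \<omega> t = v t}" by auto
    also have "\<dots> \<in> sets M" by measurable
    finally show "?C v \<in> sets M" .
  next
    show "countable (PiE {..n} A)"
      by (intro countable_PiE) (auto intro: countable_subset[OF A V])
  next
    show "disjoint_family_on ?C (PiE {..n} A)"
    proof (unfold disjoint_family_on_def, intro ballI impI)
      fix u v assume "u \<in> PiE {..n} A" "v \<in> PiE {..n} A" "u \<noteq> v"
      then obtain t where "t \<le> n" "u t \<noteq> v t"
        by (meson PiE_ext atMost_iff)
      then show "?C u \<inter> ?C v = {}" by auto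
    qed
  qed
  finally show ?thesis .
qed

text \<open>Path probabilities are known for initial segments of time, so a condition at the times
  in \<open>J\<close> is padded to all times up to n by the trivial condition
  \<open>V\<close>.\<close>

lemma vimage_prod_emb_path_space:
  assumes "X \<in> measurable M (path_space V)" "J \<subseteq> {..n}"
  shows "X -` prod_emb UNIV (\<lambda>_. count_space V) J (PiE J A) \<inter> space M =
    {\<omega> \<in> space M. \<forall>t\<le>n. X \<omega> t \<in> (if t \<in> J then A t else V)}"
proof -
  have "X \<omega> t \<in> V" if "\<omega> \<in> space M" for \<omega> t
    using measurable_space[OF assms(1) that] by (auto simp: space_path_space)
  then show ?thesis
    using assms(2) by (auto simp: prod_emb_def PiE_iff subset_iff)
qed

text \<open>Finite-dimensional rectangles determine a law on path space. The resulting common law of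
  the walks is what makes them exchangeable.\<close>

lemma simple_random_walk_distr_eq:
  assumes M: "prob_space M" and N: "prob_space N" and V: "countable V"
    and X: "simple_random_walk M V E r X" and Y: "simple_random_walk N V E r Y"
  shows "distr M (path_space V) X = distr N (path_space V) Y"
proof -
  interpret M: prob_space M by fact
  interpret N: prob_space N by fact
  have Xm: "X \<in> measurable M (path_space V)" and Ym: "Y \<in> measurable N (path_space V)"
    using X Y by (simp_all add: simple_random_walk_def)
  show ?thesis
  proof (rule measure_eqI_PiM_infinite[where I = UNIV and M = "\<lambda>_. count_space V"])
    fix J :: "nat set" and A
    assume J: "finite J" and A: "\<And>i. i \<in> J \<Longrightarrow> A i \<in> sets (count_space V)"
    obtain n where n: "J \<subseteq> {..n}"
      using J finite_nat_set_iff_bounded_le by (metis atMost_iff subsetI)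
    define B where "B t = (if t \<in> J then A t else V)" for t
    have B: "B t \<subseteq> V" for t
      using A by (auto simp: B_def)
    let ?R = "prod_emb UNIV (\<lambda>_. count_space V) J (PiE J A)"
    have R: "?R \<in> sets (path_space V)"
      unfolding path_space_def using J A by (intro sets_PiM_I) auto
    have "emeasure (distr M (path_space V) X) ?R =
        (\<integral>\<^sup>+ v. emeasure M {\<omega> \<in> space M. \<forall>t\<le>n. X \<omega> t = v t} \<partial>count_space (PiE {..n} B))"
      unfolding emeasure_distr[OF Xm R] vimage_prod_emb_path_space[OF Xm n] B_def[symmetric]
      by (rule emeasure_path_rectangle[OF V Xm B])
    also have "\<dots> = (\<integral>\<^sup>+ v. emeasure N {\<omega> \<in> space N. \<forall>t\<le>n. Y \<omega> t = v t} \<partial>count_space (PiE {..n} B))"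
    proof (rule nn_integral_cong)
      fix v assume "v \<in> space (count_space (PiE {..n} B))"
      then have "v t \<in> V" if "t \<le> n" for t
        using B that by (auto simp: PiE_iff)
      from simple_random_walk_cylinder_eq[OF M N X Y this]
      show "emeasure M {\<omega> \<in> space M. \<forall>t\<le>n. X \<omega> t = v t} = emeasure N {\<omega> \<in> space N. \<forall>t\<le>n. Y \<omega> t = v t}"
        by (simp add: M.emeasure_eq_measure N.emeasure_eq_measure)
    qed
    also have "\<dots> = emeasure (distr N (path_space V) Y) ?R"
      unfolding emeasure_distr[OF Ym R] vimage_prod_emb_path_space[OF Ym n] B_def[symmetric]
      by (rule emeasure_path_rectangle[OF V Ym B, symmetric])
    finally show "emeasure (distr M (path_space V) X) ?R = emeasure (distr N (path_space V) Y) ?R" .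
  next
    interpret D: prob_space "distr M (path_space V) X"
      by (rule M.prob_space_distr[OF Xm])
    show "finite_measure (distr M (path_space V) X)"
      by (rule D.finite_measure_axioms)
  qed (simp_all add: path_space_def)
qed

section \<open>Convex functions and expectations\<close>

text \<open>This is c + x split into positive and negative parts, with every negative part moved to
  the other side. The form without subtraction can be integrated even when values are
  infinite.\<close>

lemma ennreal_shift_eq:
  assumes "0 \<le> (x::real)"
  shows "ennreal (c + x) + ennreal (- c) = (ennreal (- c - x) + ennreal x) + ennreal c"
proof (cases "0 \<le> c")
  case True
  with assms show ?thesis by (simp add: ennreal_neg add.commute)
next
  case c: False
  show ?thesis
  proof (cases "0 \<le> c + x")
    case True
    with assms c have "ennreal (c + x) + ennreal (- c) = ennreal ((c + x) + (- c))"
      by (intro ennreal_plus[symmetric]) auto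
    with True c show ?thesis by (simp add: ennreal_neg)
  next
    case False
    with assms c have "ennreal (- c - x) + ennreal x = ennreal ((- c - x) + x)"
      by (intro ennreal_plus[symmetric]) auto
    with False c show ?thesis by (simp add: ennreal_neg)
  qed
qed

lemma e2ennreal_shift_eq:
  fixes c :: real and F :: ennreal
  shows "e2ennreal (ereal c + enn2ereal F) + ennreal (- c) =
        (e2ennreal (- (ereal c + enn2ereal F)) + F) + ennreal c"
proof (cases F)
  case (real x)
  then have "enn2ereal F = ereal x" by simp
  then show ?thesis
    using ennreal_shift_eq[OF real(1), of c] unfolding real(2) by simp
qed simp

text \<open>The parts of c and the term N are finite and can be moved back across the equation; P is
  infinite exactly when I is.\<close>

lemma enn2ereal_diff_eqI:
  assumes eq: "P + ennreal (- c) = (N + I) + ennreal c" and N: "N < top"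
  shows "enn2ereal P - enn2ereal N = ereal c + enn2ereal I"
proof -
  obtain n where n: "N = ennreal n" "0 \<le> n"
    using N by (cases N) auto
  show ?thesis
  proof (cases I)
    case (real x)
    have "P + ennreal (- c) \<noteq> top"
      unfolding eq n real by simp
    then have "P \<noteq> top" by auto
    then obtain p where p: "P = ennreal p" "0 \<le> p" by (cases P) auto
    have "ennreal (p + max 0 (- c)) = P + ennreal (- c)"
      unfolding p(1) by (subst ennreal_plus) (use p in auto)
    also have "\<dots> = ennreal (n + x + max 0 c)"
      unfolding eq n(1) real(2) by (subst ennreal_plus, (use n real in auto)[2], subst ennreal_plus) (use n real in auto)
    finally have "p + max 0 (- c) = n + x + max 0 c"
      by (subst (asm) ennreal_inj) (use n p real in auto)
    then have "p - n = c + x" by linarith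
    then show ?thesis
      by (simp add: n p real)
  next
    case top
    with eq have "P = top" by simp
    with n top show ?thesis by simp
  qed
qed

text \<open>Reduces extended expectations of variables bounded below to nonnegative integrals, for
  which existence is automatic.\<close>

lemma (in prob_space) ext_expectation_bounded_below:
  assumes F: "F \<in> borel_measurable M"
  shows "expectation_exists M (\<lambda>\<omega>. ereal c + enn2ereal (F \<omega>))" (is ?exists)
    and "ext_expectation M (\<lambda>\<omega>. ereal c + enn2ereal (F \<omega>)) = ereal c + enn2ereal (\<integral>\<^sup>+ \<omega>. F \<omega> \<partial>M)" (is ?eq)
proof -
  note F[measurable]
  let ?P = "\<integral>\<^sup>+ \<omega>. e2ennreal (ereal c + enn2ereal (F \<omega>)) \<partial>M"
  let ?N = "\<integral>\<^sup>+ \<omega>. e2ennreal (- (ereal c + enn2ereal (F \<omega>))) \<partial>M"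
  \<comment> \<open>The negative part is at most that of the constant c, so only the positive part
    can have infinite integral.\<close>
  have "?N \<le> (\<integral>\<^sup>+ \<omega>. ennreal (- c) \<partial>M)"
  proof (rule nn_integral_mono)
    fix \<omega>
    have "- (ereal c + enn2ereal (F \<omega>)) \<le> ereal (- c)"
      by (cases "enn2ereal (F \<omega>)" rule: ereal_cases) (use enn2ereal_nonneg[of "F \<omega>"] in auto)
    then show "e2ennreal (- (ereal c + enn2ereal (F \<omega>))) \<le> ennreal (- c)"
      using e2ennreal_mono e2ennreal_ereal by metis
  qed
  then have N: "?N < top"
    by (simp add: emeasure_space_1 le_less_trans)
  then show ?exists
    by (simp add: expectation_exists_def)
  have "?P + ennreal (- c) = (\<integral>\<^sup>+ \<omega>. e2ennreal (ereal c + enn2ereal (F \<omega>)) + ennreal (- c) \<partial>M)"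
    by (subst nn_integral_add) (simp_all add: emeasure_space_1)
  also have "\<dots> = (\<integral>\<^sup>+ \<omega>. (e2ennreal (- (ereal c + enn2ereal (F \<omega>))) + F \<omega>) + ennreal c \<partial>M)"
  proof (rule nn_integral_cong)
    fix \<omega>
    show "e2ennreal (ereal c + enn2ereal (F \<omega>)) + ennreal (- c) =
        (e2ennreal (- (ereal c + enn2ereal (F \<omega>))) + F \<omega>) + ennreal c"
      by (rule e2ennreal_shift_eq)
  qed
  also have "\<dots> = (?N + (\<integral>\<^sup>+ \<omega>. F \<omega> \<partial>M)) + ennreal c"
    by (subst nn_integral_add, simp, simp, subst nn_integral_add) (simp_all add: emeasure_space_1)
  finally have eq: "?P + ennreal (- c) = (?N + (\<integral>\<^sup>+ \<omega>. F \<omega> \<partial>M)) + ennreal c" .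
  show ?eq
    unfolding ext_expectation_def by (rule enn2ereal_diff_eqI[OF eq N])
qed

section \<open>Increasing convex functions extended to infinity\<close>

text \<open>To the right of b the function lies above the line through its points at a and b, which
  has positive slope \<open>?s\<close>.\<close>

lemma convex_on_nonconst_at_top:
  fixes \<phi> :: "real \<Rightarrow> real"
  assumes "convex_on UNIV \<phi>" and ab: "a < b" "\<phi> a < \<phi> b"
  shows "filterlim \<phi> at_top at_top"
proof -
  let ?s = "(\<phi> b - \<phi> a) / (b - a)"
  have "\<phi> a + ?s * (x - a) \<le> \<phi> x" if "b \<le> x" for x
  proof -
    have "\<phi> b \<le> (\<phi> x - \<phi> a) / (x - a) * (b - a) + \<phi> a"
      using that ab by (intro convex_onD_Icc' convex_on_subset[OF assms(1)]) auto
    then have "(\<phi> b - \<phi> a) \<le> (\<phi> x - \<phi> a) / (x - a) * (b - a)" by simp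
    then have "?s \<le> (\<phi> x - \<phi> a) / (x - a)"
      using ab by (simp add: pos_divide_le_eq)
    then show ?thesis
      using that ab by (simp add: pos_le_divide_eq)
  qed
  then have "eventually (\<lambda>x. \<phi> a + ?s * (x - a) \<le> \<phi> x) at_top"
    by (rule eventually_mono[OF eventually_ge_at_top[of b]])
  moreover have "filterlim (\<lambda>x. \<phi> a + ?s * (x - a)) at_top at_top"
  proof -
    have "?s > 0" using ab by simp
    moreover have "filterlim (\<lambda>x. - a + x) at_top at_top"
      by (rule filterlim_tendsto_add_at_top[OF tendsto_const filterlim_ident])
    ultimately have "filterlim (\<lambda>x. ?s * (- a + x)) at_top at_top"
      by (intro filterlim_tendsto_pos_mult_at_top[OF tendsto_const])
    then show ?thesis
      by (intro filterlim_tendsto_add_at_top[OF tendsto_const]) simp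
  qed
  ultimately show ?thesis
    by (rule filterlim_at_top_mono[rotated])
qed

text \<open>Normalising by \<open>\<phi> 0\<close> gives a nonnegative function on the range of lifespans, so that all
  expectations become nonnegative integrals.\<close>

definition shifted_extension :: "(real \<Rightarrow> real) \<Rightarrow> enat \<Rightarrow> ennreal" where
  "shifted_extension \<phi> x = (case x of
     enat n \<Rightarrow> ennreal (\<phi> (real n) - \<phi> 0)
   | \<infinity> \<Rightarrow> if \<exists>u\<ge>0. \<phi> 0 < \<phi> u then top else 0)"

context
  fixes \<phi> :: "real \<Rightarrow> real"
  assumes mono_phi: "mono \<phi>" and convex_phi: "convex_on UNIV \<phi>"
begin

text \<open>On the nonnegative half-line \<phi> is either constant or unbounded, so its limit is
  \<open>\<phi> 0\<close> or infinity; the value of \<open>shifted_extension\<close> at infinity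
  encodes this dichotomy.\<close>

lemma extend_fun_eq_shifted_extension:
  "extend_fun \<phi> (ereal_of_enat x) = ereal (\<phi> 0) + enn2ereal (shifted_extension \<phi> x)"
proof (cases x)
  case (enat n)
  have "\<phi> 0 \<le> \<phi> (real n)" by (rule monoD[OF mono_phi]) simp
  then have "ereal (\<phi> (real n)) = ereal (\<phi> 0) + enn2ereal (ennreal (\<phi> (real n) - \<phi> 0))"
    by simp
  moreover have "extend_fun \<phi> (ereal_of_enat (enat n)) = ereal (\<phi> (real n))"
    and "shifted_extension \<phi> (enat n) = ennreal (\<phi> (real n) - \<phi> 0)"
    by (simp_all add: extend_fun_def shifted_extension_def)
  ultimately show ?thesis unfolding enat by metis
next
  case infinity
  show ?thesis
  proof (cases "\<exists>u\<ge>0. \<phi> 0 < \<phi> u")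
    case False
    have const: "\<phi> u = \<phi> 0" if "0 \<le> u" for u
      using False that monoD[OF mono_phi that] by (metis antisym not_less)
    have "eventually (\<lambda>u. ereal (\<phi> u) = ereal (\<phi> 0)) at_top"
      by (rule eventually_mono[OF eventually_ge_at_top[of 0]]) (metis const)
    then have "Lim at_top (\<lambda>u. ereal (\<phi> u)) = ereal (\<phi> 0)"
      by (intro tendsto_Lim tendsto_eventually) simp_all
    with False show ?thesis
      by (simp add: infinity extend_fun_def shifted_extension_def zero_ennreal.rep_eq)
  next
    case True
    then obtain u where u: "u \<ge> 0" "\<phi> 0 < \<phi> u" by auto
    then have "0 < u" by (metis order_le_less order_less_irrefl)
    moreover note u(2)
    ultimately have "filterlim \<phi> at_top at_top"
      by (rule convex_on_nonconst_at_top[OF convex_phi])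
    then have "((\<lambda>u. ereal (\<phi> u)) \<longlongrightarrow> \<infinity>) at_top"
      by (simp add: tendsto_PInfty_eq_at_top)
    then have "Lim at_top (\<lambda>u. ereal (\<phi> u)) = \<infinity>"
      by (intro tendsto_Lim) auto
    with True show ?thesis
      by (simp add: infinity extend_fun_def shifted_extension_def)
  qed
qed

text \<open>Disposes of infinite arguments: either the value there is \<open>top\<close> and bounds
  everything, or \<phi> is constant on the nonnegative half-line and all values vanish.\<close>

lemma shifted_extension_infinity_neq_top:
  assumes "shifted_extension \<phi> \<infinity> \<noteq> top"
  shows "shifted_extension \<phi> x = 0"
proof (cases x)
  case (enat n)
  have "\<not> (\<exists>u\<ge>0. \<phi> 0 < \<phi> u)"
    by (rule notI) (use assms in \<open>simp add: shifted_extension_def\<close>)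
  then have "\<phi> (real n) \<le> \<phi> 0" by (simp add: not_less)
  then show ?thesis by (simp add: enat shifted_extension_def ennreal_neg)
next
  case infinity
  with assms show ?thesis by (auto simp: shifted_extension_def split: if_splits)
qed

lemma mono_shifted_extension: "mono (shifted_extension \<phi>)"
proof
  fix x y :: enat assume "x \<le> y"
  show "shifted_extension \<phi> x \<le> shifted_extension \<phi> y"
  proof (cases y)
    case (enat n)
    with \<open>x \<le> y\<close> obtain m where "x = enat m" "m \<le> n" by (cases x) auto
    then have "\<phi> (real m) \<le> \<phi> (real n)"
      by (intro monoD[OF mono_phi]) simp
    then show ?thesis
      by (simp add: \<open>x = enat m\<close> enat shifted_extension_def ennreal_leI)
  next
    case infinity
    then show ?thesis
      using shifted_extension_infinity_neq_top[of x] by (cases "shifted_extension \<phi> \<infinity> = top") auto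
  qed
qed

text \<open>The two middle points are convex combinations of the outer two with complementary
  weights, so adding the two convexity inequalities gives each outer value total weight 1.\<close>

lemma shifted_extension_increments:
  "shifted_extension \<phi> (a + b) + shifted_extension \<phi> (a + c)
     \<le> shifted_extension \<phi> a + shifted_extension \<phi> (a + b + c)"
proof (cases "a + b + c = \<infinity>")
  case True
  then show ?thesis
    using shifted_extension_infinity_neq_top by (cases "shifted_extension \<phi> \<infinity> = top") auto
next
  case False
  then obtain i j k where ijk: "a = enat i" "b = enat j" "c = enat k"
    by (cases a; cases b; cases c) auto
  have le: "\<phi> 0 \<le> \<phi> (real n)" for n by (rule monoD[OF mono_phi]) simp
  have "\<phi> (real (i + j)) + \<phi> (real (i + k)) \<le> \<phi> (real i) + \<phi> (real (i + j + k))"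
  proof (cases "j + k = 0")
    case False
    \<comment> \<open>The weight that places i + j between i and i + j + k; the excluded case j + k
      = 0 would make it 0/0.\<close>
    define t where "t = real j / (real j + real k)"
    have t: "0 \<le> t" "t \<le> 1" using False by (auto simp: t_def divide_le_eq_1)
    have "real j + real k \<noteq> 0" using False by linarith
    then have "t * (real j + real k) = real j" by (simp add: t_def)
    then have "(1 - t) * real i + t * real (i + j + k) = real (i + j)"
      and "(1 - (1 - t)) * real i + (1 - t) * real (i + j + k) = real (i + k)"
      by (simp_all add: algebra_simps)
    moreover have "\<phi> ((1 - t) * real i + t * real (i + j + k)) \<le> (1 - t) * \<phi> (real i) + t * \<phi> (real (i + j + k))"
      using convex_onD[OF convex_phi t] by simp
    moreover have "\<phi> ((1 - (1 - t)) * real i + (1 - t) * real (i + j + k))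
        \<le> (1 - (1 - t)) * \<phi> (real i) + (1 - t) * \<phi> (real (i + j + k))"
      using t convex_onD[OF convex_phi, of "1 - t"] by simp
    ultimately show ?thesis by (simp add: algebra_simps)
  qed simp
  then have "ennreal (\<phi> (real (i + j)) - \<phi> 0 + (\<phi> (real (i + k)) - \<phi> 0))
      \<le> ennreal (\<phi> (real i) - \<phi> 0 + (\<phi> (real (i + j + k)) - \<phi> 0))"
    by (intro ennreal_leI) linarith
  then have "ennreal (\<phi> (real (i + j)) - \<phi> 0) + ennreal (\<phi> (real (i + k)) - \<phi> 0)
      \<le> ennreal (\<phi> (real i) - \<phi> 0) + ennreal (\<phi> (real (i + j + k)) - \<phi> 0)"
    using le[of i] le[of "i + j"] le[of "i + k"] le[of "i + j + k"]
    by (subst (1 2) ennreal_plus[symmetric]) auto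
  then show ?thesis
    by (simp add: ijk shifted_extension_def)
qed

end

section \<open>Convex sequences as combinations of hinges\<close>

lemma convex_sequence_eq_hinge_sum:
  fixes g :: "nat \<Rightarrow> ennreal"
  assumes g0: "g 0 = 0" and mono: "\<And>n. g n \<le> g (Suc n)"
    and convex: "\<And>n. 2 * g (Suc n) \<le> g n + g (Suc (Suc n))"
  obtains c :: "nat \<Rightarrow> ennreal" where "\<And>n. g n = (\<Sum>k. c k * of_nat (n - k))"
proof -
  \<comment> \<open>The initial slope, followed by the second differences; the hinge at k bends only
    at k, so these are the only possible weights for finite sequences. \<open>c_Suc\<close> undoes
    the subtraction and holds for infinite values too.\<close>
  define c where "c k = (case k of 0 \<Rightarrow> g 1 | Suc k \<Rightarrow> g k + g (Suc (Suc k)) - 2 * g (Suc k))" for k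
  define h where "h n = (\<Sum>k<n. c k * of_nat (n - k))" for n
  have c_Suc: "c (Suc n) + 2 * g (Suc n) = g n + g (Suc (Suc n))" for n
    unfolding c_def nat.case using convex by (rule diff_add_cancel_ennreal)
  have h_rec: "h n + h (Suc (Suc n)) = c (Suc n) + 2 * h (Suc n)" for n
  proof -
    have "(\<Sum>k<n. c k * of_nat (n - k)) + (\<Sum>k<n. c k * of_nat (Suc (Suc n) - k)) =
        (\<Sum>k<n. 2 * (c k * of_nat (Suc n - k)))"
      unfolding sum.distrib[symmetric]
    proof (rule sum.cong)
      fix k assume "k \<in> {..<n}"
      then obtain j where "n = k + j" by (auto dest: less_imp_add_positive)
      then show "c k * of_nat (n - k) + c k * of_nat (Suc (Suc n) - k) = 2 * (c k * of_nat (Suc n - k))"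
        by (simp add: Suc_diff_le distrib_left distrib_right mult_2 mult_2_right ac_simps)
    qed simp
    \<comment> \<open>In the terms beyond the common range, those at k = n balance as twice
      \<open>c n\<close> on either side, and k = n + 1 leaves exactly
      \<open>c (Suc n)\<close>.\<close>
    moreover have "Suc (Suc n) - n = 2" "Suc n - n = 1" "Suc (Suc n) - Suc n = 1" by simp_all
    ultimately show ?thesis
      unfolding h_def sum.lessThan_Suc
      by (simp add: sum_distrib_left[symmetric] sum.distrib distrib_left mult_2 ac_simps)
  qed
  \<comment> \<open>The recursion has order two, so the induction carries two consecutive
    values.\<close>
  have "g n = h n \<and> g (Suc n) = h (Suc n)" for n
  proof (induction n)
    case 0
    show ?case by (simp add: g0 h_def c_def)
  next
    case (Suc n)
    have "g (Suc (Suc n)) = h (Suc (Suc n))"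
    proof (cases "g n = top")
      case False
      have "g n + g (Suc (Suc n)) = g n + h (Suc (Suc n))"
        using c_Suc[of n] h_rec[of n] Suc by metis
      with False show ?thesis
        by (simp add: ennreal_add_left_cancel)
    next
      \<comment> \<open>An infinite \<open>g n\<close> cannot be cancelled. Then g is infinite from
        here on by monotonicity, and so is h, which agrees with g at \<open>Suc n\<close> and
        increases.\<close>
      case True
      then have "g (Suc n) = top"
        using mono[of n] by (simp add: top_unique)
      moreover from this have "g (Suc (Suc n)) = top"
        using mono[of "Suc n"] by (simp add: top_unique)
      moreover have "h (Suc n) \<le> h (Suc (Suc n))"
        unfolding h_def sum.lessThan_Suc[of _ "Suc n"]
        by (intro add_increasing2 sum_mono mult_left_mono of_nat_mono) auto
      ultimately show ?thesis
        using Suc by (simp add: top_unique)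
    qed
    with Suc show ?case by simp
  qed
  \<comment> \<open>Truncated subtraction makes all terms with k at least n vanish, so the series is
    a finite sum.\<close>
  then have "g n = (\<Sum>k. c k * of_nat (n - k))" for n
    unfolding h_def by (subst suminf_finite[of "{..<n}"]) auto
  then show ?thesis by (rule that)
qed

text \<open>The index has countably many values, so the integral splits over the events that X
  equals n, on each of which independence factors out the integral over Y.\<close>

lemma nn_integral_indep_index:
  fixes X :: "'a \<Rightarrow> nat"
  assumes "prob_space M" and indep: "indep_variables M (count_space UNIV) X N Y"
    and h: "\<And>n. h n \<in> borel_measurable N"
  shows "(\<integral>\<^sup>+ \<omega>. h (X \<omega>) (Y \<omega>) \<partial>M) = (\<integral>\<^sup>+ \<omega>. (\<integral>\<^sup>+ \<omega>'. h (X \<omega>) (Y \<omega>') \<partial>M) \<partial>M)"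
proof -
  interpret prob_space M by fact
  have X[measurable]: "X \<in> measurable M (count_space UNIV)" and Y[measurable]: "Y \<in> measurable M N"
    using indep by (auto simp: indep_variables_def)
  note h[measurable]
  let ?B = "\<lambda>n. X -` {n} \<inter> space M"
  have split: "F (X \<omega>) \<omega> = (\<Sum>n. indicator (?B n) \<omega> * F n \<omega>)"
    if "\<omega> \<in> space M" for F :: "nat \<Rightarrow> 'a \<Rightarrow> ennreal" and \<omega>
    using that by (subst suminf_finite[of "{X \<omega>}"]) auto
  have B[measurable]: "?B n \<in> sets M" for n
    by (rule measurable_sets[OF X]) simp
  have prod: "(\<integral>\<^sup>+ \<omega>. indicator (?B n) \<omega> * h n (Y \<omega>) \<partial>M) = emeasure M (?B n) * (\<integral>\<^sup>+ \<omega>. h n (Y \<omega>) \<partial>M)" for n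
  proof -
    \<comment> \<open>Restricting to the event X = n only rescales the law of Y by the probability
      of that event. This transfers independence from sets to the integrand
      \<open>h n\<close>.\<close>
    have "distr (density M (indicator (?B n))) N Y = scale_measure (emeasure M (?B n)) (distr M N Y)"
    proof (rule measure_eqI)
      fix C assume "C \<in> sets (distr (density M (indicator (?B n))) N Y)"
      then have C[measurable]: "C \<in> sets N" by simp
      have YC[measurable]: "Y -` C \<inter> space M \<in> sets M" by measurable
      have "emeasure (distr (density M (indicator (?B n))) N Y) C = emeasure M (?B n \<inter> (Y -` C \<inter> space M))"
        by (subst emeasure_distr) (simp_all add: emeasure_density nn_integral_indicator flip: indicator_inter_arith)
      also have "prob (?B n \<inter> (Y -` C \<inter> space M)) = prob (?B n) * prob (Y -` C \<inter> space M)"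
        using indep unfolding indep_variables_def by (intro indep_setD) auto
      then have "emeasure M (?B n \<inter> (Y -` C \<inter> space M)) = emeasure M (?B n) * emeasure M (Y -` C \<inter> space M)"
        by (simp add: emeasure_eq_measure ennreal_mult)
      finally show "emeasure (distr (density M (indicator (?B n))) N Y) C =
          emeasure (scale_measure (emeasure M (?B n)) (distr M N Y)) C"
        by (simp add: emeasure_distr)
    qed simp
    then have "(\<integral>\<^sup>+ y. h n y \<partial>distr (density M (indicator (?B n))) N Y) =
        emeasure M (?B n) * (\<integral>\<^sup>+ y. h n y \<partial>distr M N Y)"
      by (simp add: nn_integral_scale_measure)
    then show ?thesis
      by (simp add: nn_integral_distr nn_integral_density)
  qed
  have "(\<integral>\<^sup>+ \<omega>. h (X \<omega>) (Y \<omega>) \<partial>M) = (\<integral>\<^sup>+ \<omega>. (\<Sum>n. indicator (?B n) \<omega> * h n (Y \<omega>)) \<partial>M)"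
    by (rule nn_integral_cong) (rule split)
  also have "\<dots> = (\<Sum>n. emeasure M (?B n) * (\<integral>\<^sup>+ \<omega>. h n (Y \<omega>) \<partial>M))"
    by (subst nn_integral_suminf, measurable) (simp add: prod)
  also have "\<dots> = (\<integral>\<^sup>+ \<omega>. (\<Sum>n. indicator (?B n) \<omega> * (\<integral>\<^sup>+ \<omega>'. h n (Y \<omega>') \<partial>M)) \<partial>M)"
    by (subst nn_integral_suminf, measurable) (simp add: nn_integral_multc B)
  also have "\<dots> = (\<integral>\<^sup>+ \<omega>. (\<integral>\<^sup>+ \<omega>'. h (X \<omega>) (Y \<omega>') \<partial>M) \<partial>M)"
    by (rule nn_integral_cong) (rule split[symmetric])
  finally show ?thesis .
qed

section \<open>Convexity of the total lifespan\<close>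

text \<open>Since g may be infinite it need not come from a real convex function; the order is
  therefore applied to each hinge and the inequalities are summed with the weights
  \<open>c\<close>.\<close>

lemma icx_le_nat_imp_nn_integral_le:
  fixes X :: "'a \<Rightarrow> nat" and Y :: "'b \<Rightarrow> nat"
  assumes M: "prob_space M" and N: "prob_space N"
    and X[measurable]: "X \<in> measurable M (count_space UNIV)"
    and Y[measurable]: "Y \<in> measurable N (count_space UNIV)"
    and icx: "icx_le M (\<lambda>\<omega>. ereal (real (X \<omega>))) N (\<lambda>\<omega>. ereal (real (Y \<omega>)))"
    and g: "g 0 = 0" "\<And>n. g n \<le> g (Suc n)" "\<And>n. 2 * g (Suc n) \<le> g n + g (Suc (Suc n))"
  shows "(\<integral>\<^sup>+ \<omega>. g (X \<omega>) \<partial>M) \<le> (\<integral>\<^sup>+ \<omega>. g (Y \<omega>) \<partial>N)"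
proof -
  interpret M: prob_space M by fact
  interpret N: prob_space N by fact
  have hinge: "(\<integral>\<^sup>+ \<omega>. of_nat (X \<omega> - k) \<partial>M) \<le> (\<integral>\<^sup>+ \<omega>. of_nat (Y \<omega> - k) \<partial>N)" for k
  proof -
    define \<phi> :: "real \<Rightarrow> real" where "\<phi> x = max 0 (x - real k)" for x
    have convex: "convex_on UNIV \<phi>"
    proof (rule convex_onI)
      fix t x y :: real assume t: "0 < t" "t < 1"
      have "(1 - t) * (x - real k) + t * (y - real k) \<le> (1 - t) * \<phi> x + t * \<phi> y"
        using t by (intro add_mono mult_left_mono) (auto simp: \<phi>_def)
      moreover have "0 \<le> (1 - t) * \<phi> x + t * \<phi> y"
        using t by (simp add: \<phi>_def)
      ultimately show "\<phi> ((1 - t) *\<^sub>R x + t *\<^sub>R y) \<le> (1 - t) * \<phi> x + t * \<phi> y"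
        unfolding \<phi>_def[of "(1 - t) *\<^sub>R x + t *\<^sub>R y"]
        by (intro max.boundedI) (simp_all add: algebra_simps)
    qed simp
    have mono: "mono \<phi>" by (auto simp: \<phi>_def mono_def)
    \<comment> \<open>The summand \<open>ereal 0\<close> matches the bounded-below form with c = 0,
      ready for folding.\<close>
    have ext: "extend_fun \<phi> (ereal (real n)) = ereal 0 + enn2ereal (of_nat (n - k))" for n
      by (simp add: extend_fun_def \<phi>_def of_nat_diff max_def)
    have "(\<lambda>\<omega>. of_nat (X \<omega> - k) :: ennreal) \<in> borel_measurable M" by measurable
    note MX = M.ext_expectation_bounded_below[OF this, of 0, folded ext]
    have "(\<lambda>\<omega>. of_nat (Y \<omega> - k) :: ennreal) \<in> borel_measurable N" by measurable
    note NY = N.ext_expectation_bounded_below[OF this, of 0, folded ext]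
    have "ext_expectation M (\<lambda>\<omega>. extend_fun \<phi> (ereal (real (X \<omega>))))
        \<le> ext_expectation N (\<lambda>\<omega>. extend_fun \<phi> (ereal (real (Y \<omega>))))"
      using icx convex mono MX(1) NY(1) unfolding icx_le_def by blast
    then have "enn2ereal (\<integral>\<^sup>+ \<omega>. of_nat (X \<omega> - k) \<partial>M) \<le> enn2ereal (\<integral>\<^sup>+ \<omega>. of_nat (Y \<omega> - k) \<partial>N)"
      unfolding MX(2) NY(2) by simp
    then show ?thesis by (simp add: less_eq_ennreal.rep_eq)
  qed
  obtain c where c: "\<And>n. g n = (\<Sum>k. c k * of_nat (n - k))"
    using convex_sequence_eq_hinge_sum[of g] g by blast
  have "(\<integral>\<^sup>+ \<omega>. g (X \<omega>) \<partial>M) = (\<Sum>k. c k * (\<integral>\<^sup>+ \<omega>. of_nat (X \<omega> - k) \<partial>M))"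
    unfolding c by (subst nn_integral_suminf) (simp_all add: nn_integral_cmult)
  also have "\<dots> \<le> (\<Sum>k. c k * (\<integral>\<^sup>+ \<omega>. of_nat (Y \<omega> - k) \<partial>N))"
    by (intro suminf_le mult_left_mono hinge) auto
  also have "\<dots> = (\<integral>\<^sup>+ \<omega>. g (Y \<omega>) \<partial>N)"
    unfolding c by (subst nn_integral_suminf) (simp_all add: nn_integral_cmult)
  finally show ?thesis .
qed

text \<open>Working under the product law makes the exchange of two walks a reindexing of
  coordinates. \<open>incr\<close> states convexity in a form that makes sense for infinite
  lifespans.\<close>

lemma nn_integral_idla_total_lifespan_convex:
  fixes V :: "'v set" and f :: "enat \<Rightarrow> ennreal"
  assumes \<mu>: "prob_space \<mu>" and sets: "sets \<mu> = sets (path_space V)"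
    and V: "countable V" "r \<in> V" and mono: "mono f"
    and incr: "\<And>a b c. f (a + b) + f (a + c) \<le> f a + f (a + b + c)"
  defines "P \<equiv> PiM UNIV (\<lambda>_::nat. \<mu>)"
  shows "2 * (\<integral>\<^sup>+ w. f (idla_total_lifespan r w (Suc n)) \<partial>P) \<le>
    (\<integral>\<^sup>+ w. f (idla_total_lifespan r w n) \<partial>P) + (\<integral>\<^sup>+ w. f (idla_total_lifespan r w (Suc (Suc n))) \<partial>P)"
proof -
  let ?L = "\<lambda>w. idla_total_lifespan r w"
  let ?b = "\<lambda>w. exit_time (idla_occupied r w n) (w (Suc n))"
  let ?swap = "\<lambda>w :: nat \<Rightarrow> nat \<Rightarrow> 'v. w \<circ> Transposition.transpose n (Suc n)"
  have sets_P: "sets P = sets (PiM UNIV (\<lambda>_. path_space V))"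
    unfolding P_def by (rule sets_PiM_cong) (simp_all add: sets)
  have f: "f \<in> measurable (count_space UNIV) borel" by simp
  have L[measurable]: "(\<lambda>w. f (?L w m)) \<in> borel_measurable P" for m
    using measurable_compose[OF measurable_idla_total_lifespan[OF V] f]
    by (simp add: measurable_cong_sets[OF sets_P refl])
  have Suc_L: "?L w (Suc m) = ?L w m + exit_time (idla_occupied r w m) (w m)" for w m
    by (simp add: idla_total_lifespan_def idla_lifespan_def)
  have "(\<lambda>w. ?L w n + ?b w) \<in> measurable (PiM UNIV (\<lambda>_. path_space V)) (count_space UNIV)"
    by (rule measurable_compose_countable[OF _ measurable_idla_total_lifespan[OF V]],
        rule measurable_compose_countable[OF _ measurable_walk_exit_time[OF V]]) simp
  then have Lb[measurable]: "(\<lambda>w. f (?L w n + ?b w)) \<in> borel_measurable P"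
    using measurable_compose[OF _ f] by (simp add: measurable_cong_sets[OF sets_P refl])
  \<comment> \<open>A product of identical factors is invariant under a permutation of
    coordinates.\<close>
  have "inj (Transposition.transpose n (Suc n))" by (rule inj_on_transpose)
  then have distr: "distr P P ?swap = P"
    using distr_PiM_reindex[of UNIV "\<lambda>_. \<mu>" "Transposition.transpose n (Suc n)" UNIV] \<mu>
    by (simp add: P_def comp_def restrict_def)
  have swap: "?swap \<in> measurable P P"
    unfolding P_def comp_def by (rule measurable_PiM_single') (auto simp: space_PiM)
  have "(\<integral>\<^sup>+ w. f (?L w (Suc n)) \<partial>P) = (\<integral>\<^sup>+ w. f (?L (?swap w) (Suc n)) \<partial>P)"
    by (subst distr[symmetric], rule nn_integral_distr[OF swap]) simp
  \<comment> \<open>The swap leaves the first n walks and their occupied set alone and puts walk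
    \<open>Suc n\<close> in position \<open>n\<close>, so the new exit time is
    \<open>?b\<close>.\<close>
  also have "\<dots> = (\<integral>\<^sup>+ w. f (?L w n + ?b w) \<partial>P)"
  proof (rule nn_integral_cong)
    fix w
    have same: "?swap w i = w i" if "i < n" for i
      using that by (simp add: Transposition.transpose_def)
    have "?L (?swap w) n = ?L w n" "idla_occupied r (?swap w) n = idla_occupied r w n"
      by (rule idla_total_lifespan_cong idla_occupied_cong, erule same)+
    then show "f (?L (?swap w) (Suc n)) = f (?L w n + ?b w)"
      by (simp add: Suc_L)
  qed
  finally have exch: "(\<integral>\<^sup>+ w. f (?L w (Suc n)) \<partial>P) = (\<integral>\<^sup>+ w. f (?L w n + ?b w) \<partial>P)" .
  have "f (?L w (Suc n)) + f (?L w n + ?b w) \<le> f (?L w n) + f (?L w (Suc (Suc n)))" for w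
  proof -
    let ?a = "exit_time (idla_occupied r w n) (w n)"
    let ?c = "exit_time (idla_occupied r w (Suc n)) (w (Suc n))"
    have "?b w \<le> ?c"
      by (rule exit_time_mono[OF idla_occupied_Suc_superset])
    then have "f (?L w n + ?b w) \<le> f (?L w n + ?c)"
      by (intro monoD[OF mono] add_left_mono)
    then have "f (?L w (Suc n)) + f (?L w n + ?b w) \<le> f (?L w n + ?a) + f (?L w n + ?c)"
      unfolding Suc_L[of w n] by (rule add_left_mono)
    also have "\<dots> \<le> f (?L w n) + f (?L w n + ?a + ?c)"
      by (rule incr)
    finally show ?thesis
      unfolding Suc_L[of w "Suc n"] Suc_L[of w n] .
  qed
  then have "(\<integral>\<^sup>+ w. f (?L w (Suc n)) + f (?L w n + ?b w) \<partial>P)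
      \<le> (\<integral>\<^sup>+ w. f (?L w n) + f (?L w (Suc (Suc n))) \<partial>P)"
    by (rule nn_integral_mono)
  also have "\<dots> = (\<integral>\<^sup>+ w. f (?L w n) \<partial>P) + (\<integral>\<^sup>+ w. f (?L w (Suc (Suc n))) \<partial>P)"
    by (rule nn_integral_add) simp_all
  also have "(\<integral>\<^sup>+ w. f (?L w (Suc n)) + f (?L w n + ?b w) \<partial>P) =
      (\<integral>\<^sup>+ w. f (?L w (Suc n)) \<partial>P) + (\<integral>\<^sup>+ w. f (?L w n + ?b w) \<partial>P)"
    by (rule nn_integral_add) simp_all
  finally show ?thesis
    unfolding exch[symmetric] by (simp add: mult_2)
qed

section \<open>Transfer of the order from the indices to the total lifespans\<close>

theorem corollary1p7:
  fixes V :: "'v set" and E :: "'v \<Rightarrow> 'v \<Rightarrow> bool" and r :: 'v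
    and M :: "'a measure"
    and S :: "nat \<Rightarrow> 'a \<Rightarrow> nat \<Rightarrow> 'v"
    and \<eta> \<eta>' :: "'a \<Rightarrow> nat"
  assumes "rooted_graph V E r"
    and "prob_space M"
    and "\<And>i. simple_random_walk M V E r (S i)"
    and "prob_space.indep_vars M (\<lambda>_. path_space V) S UNIV"
    and "indep_variables M (count_space UNIV) \<eta>
           (\<Pi>\<^sub>M i\<in>UNIV. path_space V) (\<lambda>\<omega>. idla_process r (\<lambda>i. S i \<omega>))"
    and "indep_variables M (count_space UNIV) \<eta>'
           (\<Pi>\<^sub>M i\<in>UNIV. path_space V) (\<lambda>\<omega>. idla_process r (\<lambda>i. S i \<omega>))"
    and "icx_le M (\<lambda>\<omega>. ereal (real (\<eta> \<omega>))) M (\<lambda>\<omega>. ereal (real (\<eta>' \<omega>)))"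
  shows "icx_le M (\<lambda>\<omega>. ereal_of_enat (idla_total_lifespan r (\<lambda>i. S i \<omega>) (\<eta> \<omega>)))
                M (\<lambda>\<omega>. ereal_of_enat (idla_total_lifespan r (\<lambda>i. S i \<omega>) (\<eta>' \<omega>)))"
proof -
  interpret G: rooted_graph V E r by fact
  interpret prob_space M by fact
  let ?L = "\<lambda>n \<omega>. idla_total_lifespan r (\<lambda>i. S i \<omega>) n"
  let ?W = "PiM UNIV (\<lambda>_::nat. path_space V)"
  let ?Y = "\<lambda>\<omega>. idla_process r (\<lambda>i. S i \<omega>)"
  define \<mu> where "\<mu> = distr M (path_space V) (S 0)"
  note V = G.countable_vertices G.root
  have S: "S i \<in> measurable M (path_space V)" for i
    using assms(3)[of i] by (simp add: simple_random_walk_def)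
  have W: "(\<lambda>\<omega> i. S i \<omega>) \<in> measurable M ?W"
    using S by (intro measurable_PiM_single') (auto simp: measurable_def)
  have L[measurable]: "?L n \<in> measurable M (count_space UNIV)" for n
    using measurable_compose[OF W measurable_idla_total_lifespan[OF V]] .
  have eta: "\<eta> \<in> measurable M (count_space UNIV)" "\<eta>' \<in> measurable M (count_space UNIV)"
    using assms(5,6) by (simp_all add: indep_variables_def)
  have L_index: "(\<lambda>\<omega>. ?L (X \<omega>) \<omega>) \<in> measurable M (count_space UNIV)"
    if "X \<in> measurable M (count_space UNIV)" for X
    by (rule measurable_compose_countable[OF L that])
  have "distr M (path_space V) (S i) = \<mu>" for i
    unfolding \<mu>_def using assms(2,3) V by (intro simple_random_walk_distr_eq)
  \<comment> \<open>Independence together with the common law \<mu> identifies the joint law of the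
    walks as a product.\<close>
  then have law: "distr M ?W (\<lambda>\<omega> i. S i \<omega>) = PiM UNIV (\<lambda>_. \<mu>)"
    using indep_vars_iff_distr_eq_PiM[of UNIV S "\<lambda>_. path_space V"] S assms(4) by (simp add: restrict_def)
  have \<mu>: "prob_space \<mu>" "sets \<mu> = sets (path_space V)"
    unfolding \<mu>_def by (simp_all add: prob_space_distr[OF S])
  show ?thesis
    unfolding icx_le_def
  proof (intro conjI allI impI)
    show "(\<lambda>\<omega>. ereal_of_enat (?L (\<eta> \<omega>) \<omega>)) \<in> borel_measurable M"
      "(\<lambda>\<omega>. ereal_of_enat (?L (\<eta>' \<omega>) \<omega>)) \<in> borel_measurable M"
      using measurable_compose[OF L_index[OF eta(1)], of ereal_of_enat borel]
        measurable_compose[OF L_index[OF eta(2)], of ereal_of_enat borel] by simp_all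
  next
    fix \<phi> :: "real \<Rightarrow> real"
    assume "mono \<phi> \<and> convex_on UNIV \<phi> \<and>
      expectation_exists M (\<lambda>\<omega>. extend_fun \<phi> (ereal_of_enat (?L (\<eta> \<omega>) \<omega>))) \<and>
      expectation_exists M (\<lambda>\<omega>. extend_fun \<phi> (ereal_of_enat (?L (\<eta>' \<omega>) \<omega>)))"
    then have \<phi>: "mono \<phi>" "convex_on UNIV \<phi>" by auto
    let ?f = "shifted_extension \<phi>"
    define g where "g n = (\<integral>\<^sup>+ \<omega>. ?f (?L n \<omega>) \<partial>M)" for n
    have f: "?f \<in> measurable (count_space UNIV) borel" by simp
    \<comment> \<open>The same expectation under the product law, where exchangeability is
      available.\<close>
    have g_law: "g n = (\<integral>\<^sup>+ w. ?f (idla_total_lifespan r w n) \<partial>PiM UNIV (\<lambda>_. \<mu>))" for n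
      unfolding g_def law[symmetric]
      by (subst nn_integral_distr[OF W])
        (simp_all add: measurable_compose[OF measurable_idla_total_lifespan[OF V] f])
    have g: "g 0 = 0" "\<And>n. g n \<le> g (Suc n)" "\<And>n. 2 * g (Suc n) \<le> g n + g (Suc (Suc n))"
    proof -
      have "?f 0 = 0" by (simp add: shifted_extension_def zero_enat_def)
      then show "g 0 = 0" by (simp add: g_def idla_total_lifespan_def)
      show "g n \<le> g (Suc n)" for n
        unfolding g_def idla_total_lifespan_def sum.lessThan_Suc
        by (intro nn_integral_mono monoD[OF mono_shifted_extension[OF \<phi>]]) simp
      show "2 * g (Suc n) \<le> g n + g (Suc (Suc n))" for n
        unfolding g_law
        by (intro nn_integral_idla_total_lifespan_convex[OF \<mu> V] mono_shifted_extension[OF \<phi>]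
            shifted_extension_increments[OF \<phi>])
    qed
    have L_value: "ext_expectation M (\<lambda>\<omega>. extend_fun \<phi> (ereal_of_enat (?L (X \<omega>) \<omega>))) =
        ereal (\<phi> 0) + enn2ereal (\<integral>\<^sup>+ \<omega>. g (X \<omega>) \<partial>M)"
      if X: "indep_variables M (count_space UNIV) X ?W ?Y" for X
    proof -
      have Xm: "X \<in> measurable M (count_space UNIV)"
        using X by (simp add: indep_variables_def)
      \<comment> \<open>The walks are replaced by their stopped versions first, because
        \<open>X\<close> is independent of those; afterwards the expectation at each fixed index is
        \<open>g\<close>.\<close>
      have "(\<integral>\<^sup>+ \<omega>. ?f (?L (X \<omega>) \<omega>) \<partial>M) =
          (\<integral>\<^sup>+ \<omega>. ?f (idla_total_lifespan r (?Y \<omega>) (X \<omega>)) \<partial>M)"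
        by (simp add: idla_total_lifespan_process)
      also have "\<dots> = (\<integral>\<^sup>+ \<omega>. g (X \<omega>) \<partial>M)"
        using nn_integral_indep_index[OF assms(2) X, of "\<lambda>n w. ?f (idla_total_lifespan r w n)"]
          measurable_compose[OF measurable_idla_total_lifespan[OF V] f]
        by (simp add: g_def idla_total_lifespan_process)
      finally show ?thesis
        unfolding extend_fun_eq_shifted_extension[OF \<phi>]
        by (subst ext_expectation_bounded_below)
          (simp_all add: measurable_compose[OF L_index[OF Xm] f])
    qed
    have "(\<integral>\<^sup>+ \<omega>. g (\<eta> \<omega>) \<partial>M) \<le> (\<integral>\<^sup>+ \<omega>. g (\<eta>' \<omega>) \<partial>M)"
      by (rule icx_le_nat_imp_nn_integral_le[OF assms(2,2) eta assms(7) g])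
    then show "ext_expectation M (\<lambda>\<omega>. extend_fun \<phi> (ereal_of_enat (?L (\<eta> \<omega>) \<omega>))) \<le>
        ext_expectation M (\<lambda>\<omega>. extend_fun \<phi> (ereal_of_enat (?L (\<eta>' \<omega>) \<omega>)))"
      unfolding L_value[OF assms(5)] L_value[OF assms(6)]
      by (intro add_left_mono) (simp add: less_eq_ennreal.rep_eq)
  qed
qed

end
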